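(* Let $L$ be a finite-dimensional $\omega$-Lie algebra over $K$ which is not a Lie algebra. Then one of the following holds: (i) $L$ has a Lie subalgebra of codimension $1$. (ii) $\operatorname{Ker}\omega$ is an abelian or almost abelian Lie subalgebra of $L$ of codimension $2$. (iii) $L$ is an abelian extension of a simple $\omega$-Lie algebra with nondegenerate $\omega$.
   Context: $K$ is a field of characteristic different from $2$ and $3$. An $\omega$-Lie algebra is an anticommutative algebra $L$ over $K$ with multiplication $[\cdot,\cdot]$ together with a bilinear form $\omega: L\times L\to K$ (necessarily skew-symmetric) such that for all $x,y,z\in L$ $$[[x,y],z]+[[z,x],y]+[[y,z],x] = \omega(x,y)z+\omega(z,x)y+\omega(y,z)x .$$ A Lie algebra is an anticommutative algebra satisfying the Jacobi identity; a Lie subalgebra of $L$ is a subalgebra which is a Lie algebra under the bracket of $L$. $\operatorname{Ker}\omega = \{x\in L : \omega(x,L)=0\}$. An almost abelian Lie algebra is a semidirect sum $A\oplus Kx$, where $A$ is an abelian Lie algebra (an ideal) and right multiplication by $x$ acts on $A$ as the identity map. Simple means: non-abelian and without ideals other than $0$ and the whole algebra. An abelian extension of an $\omega$-Lie algebra $S$ (with form $\omega_S$) is an extension $0\to M\to E\to S\to 0$ in which $M$ is the direct sum of several (possibly zero) copies of a single $1$-dimensional $S$-module, $M$ is considered as an abelian algebra, and the form on $E$ extends $\omega_S$ trivially. Explicitly: $E$ is an $\omega$-Lie algebra with an ideal $M$ such that $[M,M]=0$, $M\subseteq \operatorname{Ker}\omega$, $E/M$ with the induced bracket and the induced form is $S$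 with $\omega_S$, and, if $M\ne0$, there is a linear form $\lambda: S\to K$ with $\omega_S(s,t)=\lambda([s,t])$ for all $s,t\in S$ and $[x,m]=\lambda(x+M)\,m$ for all $x\in E$, $m\in M$. *)

theory Defs
  imports Complex_Main
begin

text \<open>
  An algebra is given by a subspace \<open>A\<close> of an ambient vector space (with scalar multiplication
  \<open>scale\<close>) and a bracket \<open>br\<close>. All conditions are relativised to the carrier, and values of the
  operations outside the carrier are irrelevant; so a subalgebra is obtained by shrinking the
  carrier.
\<close>

definition linear_map_on ::
  "('k::field \<Rightarrow> 'a::ab_group_add \<Rightarrow> 'a) \<Rightarrow> ('k \<Rightarrow> 'b::ab_group_add \<Rightarrow> 'b) \<Rightarrow> 'a set \<Rightarrow> ('a \<Rightarrow> 'b) \<Rightarrow> bool"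
  where "linear_map_on s1 s2 V f \<longleftrightarrow>
    (\<forall>x\<in>V. \<forall>y\<in>V. f (x + y) = f x + f y) \<and> (\<forall>c. \<forall>x\<in>V. f (s1 c x) = s2 c (f x))"

definition bilinear_map_on ::
  "('k::field \<Rightarrow> 'a::ab_group_add \<Rightarrow> 'a) \<Rightarrow> ('k \<Rightarrow> 'b::ab_group_add \<Rightarrow> 'b) \<Rightarrow> 'a set \<Rightarrow> ('a \<Rightarrow> 'a \<Rightarrow> 'b) \<Rightarrow> bool"
  where "bilinear_map_on s1 s2 V f \<longleftrightarrow>
    (\<forall>x\<in>V. linear_map_on s1 s2 V (\<lambda>y. f x y)) \<and> (\<forall>y\<in>V. linear_map_on s1 s2 V (\<lambda>x. f x y))"

locale anticommutative_algebra = vector_space scale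
  for scale :: "'k::field \<Rightarrow> 'a::ab_group_add \<Rightarrow> 'a" +
  fixes A :: "'a set" and br :: "'a \<Rightarrow> 'a \<Rightarrow> 'a"
  assumes subspace_carrier: "subspace A"
    and br_closed: "x \<in> A \<Longrightarrow> y \<in> A \<Longrightarrow> br x y \<in> A"
    and br_bilinear: "bilinear_map_on scale scale A br"
    and br_anticomm: "x \<in> A \<Longrightarrow> y \<in> A \<Longrightarrow> br x y = - br y x"

locale lie_algebra = anticommutative_algebra scale A br
  for scale :: "'k::field \<Rightarrow> 'a::ab_group_add \<Rightarrow> 'a" and A br +
  assumes jacobi: "x \<in> A \<Longrightarrow> y \<in> A \<Longrightarrow> z \<in> A \<Longrightarrow>
    br (br x y) z + br (br z x) y + br (br y z) x = 0"

text \<open>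
  Skew-symmetry of \<open>om\<close> is not assumed: in characteristic other than 3 it follows from the identity
  below, applied to \<open>x, x, z\<close>.
\<close>

locale omega_lie_algebra = anticommutative_algebra scale A br
  for scale :: "'k::field \<Rightarrow> 'a::ab_group_add \<Rightarrow> 'a" and A br +
  fixes om :: "'a \<Rightarrow> 'a \<Rightarrow> 'k"
  assumes om_bilinear: "bilinear_map_on scale (*) A om"
    and omega_jacobi: "x \<in> A \<Longrightarrow> y \<in> A \<Longrightarrow> z \<in> A \<Longrightarrow>
      br (br x y) z + br (br z x) y + br (br y z) x
        = scale (om x y) z + scale (om z x) y + scale (om y z) x"

definition lie_subalgebra ::
  "('k::field \<Rightarrow> 'a::ab_group_add \<Rightarrow> 'a) \<Rightarrow> 'a set \<Rightarrow> ('a \<Rightarrow> 'a \<Rightarrow> 'a) \<Rightarrow> 'a set \<Rightarrow> bool"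
  where "lie_subalgebra scale A br H \<longleftrightarrow> H \<subseteq> A \<and> lie_algebra scale H br"

definition ideal_of ::
  "('k::field \<Rightarrow> 'a::ab_group_add \<Rightarrow> 'a) \<Rightarrow> 'a set \<Rightarrow> ('a \<Rightarrow> 'a \<Rightarrow> 'a) \<Rightarrow> 'a set \<Rightarrow> bool"
  where "ideal_of scale A br I \<longleftrightarrow> I \<subseteq> A \<and> module.subspace scale I \<and>
    (\<forall>x\<in>I. \<forall>y\<in>A. br x y \<in> I \<and> br y x \<in> I)"

definition abelian :: "'a::ab_group_add set \<Rightarrow> ('a \<Rightarrow> 'a \<Rightarrow> 'a) \<Rightarrow> bool"
  where "abelian A br \<longleftrightarrow> (\<forall>x\<in>A. \<forall>y\<in>A. br x y = 0)"

definition almost_abelian ::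
  "('k::field \<Rightarrow> 'a::ab_group_add \<Rightarrow> 'a) \<Rightarrow> 'a set \<Rightarrow> ('a \<Rightarrow> 'a \<Rightarrow> 'a) \<Rightarrow> bool"
  where "almost_abelian scale H br \<longleftrightarrow> lie_algebra scale H br \<and>
    (\<exists>A x. ideal_of scale H br A \<and> abelian A br \<and> x \<in> H \<and> x \<noteq> 0 \<and>
       H = {a + b |a b. a \<in> A \<and> b \<in> module.span scale {x}} \<and>
       A \<inter> module.span scale {x} = {0} \<and>
       (\<forall>a\<in>A. br a x = a))"

definition simple_algebra ::
  "('k::field \<Rightarrow> 'a::ab_group_add \<Rightarrow> 'a) \<Rightarrow> 'a set \<Rightarrow> ('a \<Rightarrow> 'a \<Rightarrow> 'a) \<Rightarrow> bool"
  where "simple_algebra scale A br \<longleftrightarrow> \<not> abelian A br \<and>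
    (\<forall>I. ideal_of scale A br I \<longrightarrow> I = {0} \<or> I = A)"

definition form_kernel :: "'a set \<Rightarrow> ('a \<Rightarrow> 'a \<Rightarrow> 'k::zero) \<Rightarrow> 'a set"
  where "form_kernel A om = {x \<in> A. \<forall>y\<in>A. om x y = 0}"

definition nondegenerate :: "'a::zero set \<Rightarrow> ('a \<Rightarrow> 'a \<Rightarrow> 'k::zero) \<Rightarrow> bool"
  where "nondegenerate A om \<longleftrightarrow> form_kernel A om = {0}"

text \<open>
  The extension \<open>0 \<rightarrow> M \<rightarrow> E \<rightarrow> S \<rightarrow> 0\<close> is given by a surjective homomorphism \<open>p\<close> from \<open>E\<close> onto \<open>S\<close>
  with kernel \<open>M\<close>; \<open>p\<close> identifies the quotient of \<open>E\<close> by \<open>M\<close>, with its induced bracket and form,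
  with \<open>S\<close>. The functional \<open>l\<close> is the action of \<open>S\<close> on the one-dimensional module of which \<open>M\<close> is a
  sum of copies; it is required only if \<open>M\<close> is nonzero.
\<close>

definition abelian_extension ::
  "('k::field \<Rightarrow> 'a::ab_group_add \<Rightarrow> 'a) \<Rightarrow> 'a set \<Rightarrow> ('a \<Rightarrow> 'a \<Rightarrow> 'a) \<Rightarrow> ('a \<Rightarrow> 'a \<Rightarrow> 'k) \<Rightarrow>
   ('k \<Rightarrow> 'b::ab_group_add \<Rightarrow> 'b) \<Rightarrow> 'b set \<Rightarrow> ('b \<Rightarrow> 'b \<Rightarrow> 'b) \<Rightarrow> ('b \<Rightarrow> 'b \<Rightarrow> 'k) \<Rightarrow> bool"
  where "abelian_extension scaleE E brE omE scaleS S brS omS \<longleftrightarrow>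
    omega_lie_algebra scaleE E brE omE \<and> omega_lie_algebra scaleS S brS omS \<and>
    (\<exists>M p. ideal_of scaleE E brE M \<and> abelian M brE \<and> M \<subseteq> form_kernel E omE \<and>
       linear_map_on scaleE scaleS E p \<and> p ` E = S \<and> {x \<in> E. p x = 0} = M \<and>
       (\<forall>x\<in>E. \<forall>y\<in>E. p (brE x y) = brS (p x) (p y)) \<and>
       (\<forall>x\<in>E. \<forall>y\<in>E. omE x y = omS (p x) (p y)) \<and>
       (M \<noteq> {0} \<longrightarrow>
         (\<exists>l. linear_map_on scaleS (*) S l \<and>
            (\<forall>s\<in>S. \<forall>t\<in>S. omS s t = l (brS s t)) \<and>
            (\<forall>x\<in>E. \<forall>m\<in>M. brE x m = scaleE (l (p x)) m))))"

text \<open>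
  The simple quotient \<open>S\<close> is sought on a subspace of the ambient space of \<open>L\<close>. This costs no
  generality, because any quotient of \<open>L\<close> can be transported to a linear complement of the ideal;
  \<open>brS\<close> and \<open>omS\<close> are unrelated to the operations of \<open>L\<close>.
\<close>

definition abelian_extension_of_simple ::
  "('k::field \<Rightarrow> 'a::ab_group_add \<Rightarrow> 'a) \<Rightarrow> 'a set \<Rightarrow> ('a \<Rightarrow> 'a \<Rightarrow> 'a) \<Rightarrow> ('a \<Rightarrow> 'a \<Rightarrow> 'k) \<Rightarrow> bool"
  where "abelian_extension_of_simple scale L br om \<longleftrightarrow>
    (\<exists>S brS omS. abelian_extension scale L br om scale S brS omS \<and>
       simple_algebra scale S brS \<and> nondegenerate S omS)"

end

theory Submission
  imports Defs
begin

text \<open>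
  The idea is to look at the radical \<open>Ker\<close> of the form and to let the rank of the form decide. The
  main tool is \<open>four_element_identity\<close>. Expand the brackets of two pairs out of four elements by
  the Jacobi-type identity, sum over the three pairings and evaluate the resulting Jacobi sums by
  the same identity. Then all iterated brackets are gone, and what remains is a relation between
  values of the form, single brackets and the cyclic sums
  \<open>cyc x y z = om [x,y] z + om [y,z] x + om [z,x] y\<close>. It can be solved for \<open>[y,z]\<close> as soon as the
  other two elements span a hyperbolic plane.

  Taking \<open>y\<close> and \<open>z\<close> in \<open>Ker\<close> gives \<open>[y,z] = a(y) z - a(z) y\<close> for a linear functional \<open>a\<close>
  (\<open>kernel_bracket\<close>). So \<open>Ker\<close> is a Lie subalgebra, abelian if \<open>a = 0\<close> and almost abelian
  otherwise. If the form has rank 2, then \<open>Ker\<close> has codimension 2, which is the second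
  alternative.

  If the form has rank at least 4, every hyperbolic plane has a second one orthogonal to
  it. Comparing the action of \<open>z \<in> Ker\<close> on two such planes shows that three times a certain scalar
  vanishes, and from this \<open>[y,z] \<in> Ker\<close> for all \<open>y\<close> (\<open>bracket_kernel\<close>). Hence \<open>Ker\<close> is an
  ideal, and the identity reduces to \<open>[y,z] = l(y) z\<close> with a scalar independent of \<open>z\<close>
  (\<open>scalar_action_on_kernel\<close>). The Jacobi-type identity turns this into \<open>om x y = l [x,y]\<close> when
  \<open>Ker\<close> is nonzero. Finally, an ideal containing some \<open>z\<close> outside \<open>Ker\<close> contains everything
  orthogonal to \<open>z\<close>, and with a second hyperbolic plane at hand this makes it the whole algebra
  (\<open>ideal_not_in_kernel\<close>). So the quotient by \<open>Ker\<close> is simple, and the third alternative holds.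
\<close>

section \<open>Linearity and skew-symmetry\<close>

locale total_omega_lie_algebra = omega_lie_algebra scale UNIV br om
  for scale :: "'k::field \<Rightarrow> 'a::ab_group_add \<Rightarrow> 'a" and br om +
  assumes two_nonzero: "(2::'k) \<noteq> 0" and three_nonzero: "(3::'k) \<noteq> 0"
begin

abbreviation Ker where "Ker \<equiv> form_kernel UNIV om"

lemma br_add_left: "br (x + y) z = br x z + br y z"
  and br_add_right: "br z (x + y) = br z x + br z y"
  and br_scale_left: "br (scale c x) z = scale c (br x z)"
  and br_scale_right: "br z (scale c x) = scale c (br z x)"
  using br_bilinear by (auto simp: bilinear_map_on_def linear_map_on_def)

lemma br_zero_left: "br 0 z = 0"
  and br_zero_right: "br z 0 = 0"
  using br_scale_left[of 0 0 z] br_scale_right[of z 0 0] by auto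

lemma br_minus_left: "br (- x) z = - br x z"
  and br_minus_right: "br z (- x) = - br z x"
  using br_scale_left[of "-1" x z] br_scale_right[of z "-1" x] by auto

lemma br_diff_left: "br (x - y) z = br x z - br y z"
  and br_diff_right: "br z (x - y) = br z x - br z y"
  using br_add_left[of x "- y" z] br_add_right[of z x "- y"]
  by (auto simp: br_minus_left br_minus_right)

lemmas br_linear = br_add_left br_add_right br_scale_left br_scale_right br_zero_left
  br_zero_right br_minus_left br_minus_right br_diff_left br_diff_right

lemma om_add_left: "om (x + y) z = om x z + om y z"
  and om_add_right: "om z (x + y) = om z x + om z y"
  and om_scale_left: "om (scale c x) z = c * om x z"
  and om_scale_right: "om z (scale c x) = c * om z x"
  using om_bilinear by (auto simp: bilinear_map_on_def linear_map_on_def)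

lemma om_zero_left: "om 0 z = 0"
  and om_zero_right: "om z 0 = 0"
  using om_scale_left[of 0 0 z] om_scale_right[of z 0 0] by auto

lemma om_minus_left: "om (- x) z = - om x z"
  and om_minus_right: "om z (- x) = - om z x"
  using om_scale_left[of "-1" x z] om_scale_right[of z "-1" x] by auto

lemma om_diff_left: "om (x - y) z = om x z - om y z"
  and om_diff_right: "om z (x - y) = om z x - om z y"
  using om_add_left[of x "- y" z] om_add_right[of z x "- y"]
  by (auto simp: om_minus_left om_minus_right)

lemmas om_linear = om_add_left om_add_right om_scale_left om_scale_right om_zero_left
  om_zero_right om_minus_left om_minus_right om_diff_left om_diff_right

lemma br_self: "br x x = 0"
proof -
  have "scale 2 (br x x) = br x x + br x x"
    using scale_left_distrib[of 1 1 "br x x"] by simp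
  also have "\<dots> = 0"
    using br_anticomm[of x x] by (simp add: eq_neg_iff_add_eq_0)
  finally show ?thesis
    using two_nonzero by simp
qed

lemma br_skew: "br x y = - br y x"
  by (rule br_anticomm) simp_all

text \<open>
  The identity for \<open>x, x, x\<close> has only zero brackets on its left side and \<open>3 om(x,x) x\<close> on its right;
  this is where characteristic 3 is excluded.
\<close>

lemma om_self: "om x x = 0"
proof -
  have "scale (3 * om x x) x = scale (om x x) x + scale (om x x) x + scale (om x x) x"
    by (simp flip: scale_left_distrib)
  also have "\<dots> = 0"
    using omega_jacobi[of x x x] by (simp add: br_self br_zero_left)
  finally show ?thesis
    using three_nonzero by (auto simp: om_zero_left)
qed

lemma om_skew: "om x y = - om y x"
proof -
  have "om x y + om y x = om (x + y) (x + y)"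
    unfolding om_add_left om_add_right by (simp add: om_self)
  then show ?thesis
    by (simp add: om_self eq_neg_iff_add_eq_0)
qed

section \<open>The identity in four elements\<close>

text \<open>
  The Jacobi-type identity with every pair of arguments in the order in which the variables occur,
  so that its instances can be added up without renormalising brackets.
\<close>

lemma jacobi_oriented:
  "br (br x y) z - br (br x z) y + br (br y z) x
    = scale (om x y) z - scale (om x z) y + scale (om y z) x"
  using omega_jacobi[of x y z] br_skew[of z x] om_skew[of z x] by (simp add: br_minus_left)

definition cyc where "cyc x y z = om (br x y) z + om (br y z) x + om (br z x) y"

text \<open>
  Two instances of the Jacobi-type identity, with \<open>[w,x]\<close> respectively \<open>[y,z]\<close> in the role of one
  element, involve \<open>[[y,z],[w,x]]\<close> with opposite signs. Their sum contains only brackets of the shape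
  \<open>[[[a,b],c],d]\<close> on the left. Adding the three pairings of the four elements groups these
  into Jacobi sums bracketed with the remaining element, which the identity evaluates again. Each
  term \<open>om(a,b) [c,d]\<close> arises twice in this evaluation and once from the pairings, hence survives
  once.
\<close>

lemma four_element_identity:
  "scale (om w x) (br y z) + scale (om y z) (br w x) + scale (om x y) (br w z)
      + scale (om w z) (br x y) + scale (om y w) (br x z) + scale (om x z) (br y w)
    = scale (cyc w x y) z - scale (cyc x y z) w - scale (cyc y w z) x - scale (cyc w x z) y"
proof -
  define P where "P w x y z = br (br (br w x) y) z - br (br (br w x) z) y
    + br (br (br y z) w) x - br (br (br y z) x) w" for w x y z
  have P: "P w x y z = scale (om (br w x) y) z - scale (om (br w x) z) y
      + scale (om (br y z) w) x - scale (om (br y z) x) w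
      + scale (om y z) (br w x) + scale (om w x) (br y z)" for w x y z
    using jacobi_oriented[of "br w x" y z] jacobi_oriented[of "br y z" w x]
      br_skew[of "br w x" "br y z"]
    by (simp add: P_def algebra_simps)
  define Q where "Q x y z u = br (br (br x y) z) u - br (br (br x z) y) u
    + br (br (br y z) x) u" for x y z u
  have Q: "Q x y z u = scale (om x y) (br z u) - scale (om x z) (br y u)
      + scale (om y z) (br x u)" for x y z u
    using arg_cong[OF jacobi_oriented[of x y z], of "\<lambda>v. br v u"]
    by (simp add: Q_def br_linear)
  note skew = br_skew[of z w] br_skew[of z x] br_skew[of z y] br_skew[of x w] br_skew[of y x]
    br_skew[of w y] om_skew[of z w] om_skew[of z x] om_skew[of z y] om_skew[of x w] om_skew[of y x]
    om_skew[of w y]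
  have "P w x y z + P x y w z + P y w x z = Q w x y z - Q w x z y - Q x y z w - Q y w z x"
    unfolding P_def Q_def skew br_minus_left br_minus_right
    by (simp add: algebra_simps)
  then show ?thesis
    unfolding cyc_def P Q skew br_minus_left br_minus_right om_minus_left om_minus_right
      scale_left_distrib scale_minus_left scale_minus_right
    by (simp add: algebra_simps)
qed

section \<open>Brackets of elements of the radical\<close>

lemma kernel_om: "z \<in> Ker \<Longrightarrow> om z x = 0" "z \<in> Ker \<Longrightarrow> om x z = 0"
  using om_skew[of x z] by (auto simp: form_kernel_def)

lemma mem_kernel_iff: "z \<in> Ker \<longleftrightarrow> (\<forall>x. om z x = 0)"
  by (simp add: form_kernel_def)

lemma subspace_kernel: "subspace Ker"
  by (auto simp: subspace_def mem_kernel_iff om_linear)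

lemma not_in_kernelE:
  assumes "z \<notin> Ker"
  obtains x where "om z x = 1"
proof -
  obtain x where "om z x \<noteq> 0"
    using assms by (auto simp: mem_kernel_iff)
  then have "om z (scale (inverse (om z x)) x) = 1"
    by (simp add: om_scale_right)
  then show ?thesis ..
qed

lemma eq_neg_self_iff: "(c::'k) = - c \<longleftrightarrow> c = 0"
proof
  assume "c = - c"
  then have "2 * c = 0"
    by (metis add.right_inverse mult_2)
  then show "c = 0"
    using two_nonzero by simp
qed simp

text \<open>
  The four-element identity gives \<open>v = [y,z]\<close> this form up to the extra terms
  \<open>- om(v,x) w + om(v,w) x\<close>. Pairing
  with \<open>x\<close> and with \<open>w\<close> gives \<open>om(v,x) = - om(v,x)\<close> and \<open>om(v,w) = - om(v,w)\<close>, so that these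
  terms vanish in characteristic other than 2.
\<close>

lemma kernel_bracket:
  assumes hyp: "om w x = 1" and y: "y \<in> Ker" and z: "z \<in> Ker"
  shows "br y z = scale (cyc w x y) z - scale (cyc w x z) y"
proof -
  let ?v = "br y z"
  have v: "?v = scale (cyc w x y) z - scale (cyc w x z) y - scale (om ?v x) w + scale (om ?v w) x"
    using four_element_identity[of w x y z]
    by (simp add: hyp kernel_om y z cyc_def[of x y z] cyc_def[of y w z] br_skew[of z y] om_minus_left
        algebra_simps)
  have "om ?v x = - om ?v x"
    using arg_cong[OF v, of "\<lambda>u. om u x"] by (simp add: om_linear kernel_om y z hyp om_self)
  moreover have "om ?v w = - om ?v w"
    using arg_cong[OF v, of "\<lambda>u. om u w"]
    by (simp add: om_linear kernel_om y z om_skew[of x w] hyp om_self)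
  ultimately show ?thesis
    using v by (simp add: eq_neg_self_iff)
qed

lemma cyc_linear: "cyc w x (y + z) = cyc w x y + cyc w x z" "cyc w x (scale c y) = c * cyc w x y"
  by (simp_all add: cyc_def br_linear om_linear algebra_simps)

lemma lie_subalgebra_kernel:
  assumes "om w x = 1"
  shows "lie_subalgebra scale UNIV br Ker"
proof -
  have "br y z \<in> Ker" if "y \<in> Ker" "z \<in> Ker" for y z
    using kernel_bracket[OF assms that] that subspace_kernel
    by (simp add: subspace_diff subspace_scale)
  moreover have "br (br x y) z + br (br z x) y + br (br y z) x = 0"
    if "x \<in> Ker" "y \<in> Ker" "z \<in> Ker" for x y z
    using omega_jacobi[of x y z] by (simp add: kernel_om that)
  ultimately have "lie_algebra scale Ker br"
    by unfold_locales
      (auto simp: subspace_kernel bilinear_map_on_def linear_map_on_def br_linear intro: br_skew)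
  then show ?thesis
    by (simp add: lie_subalgebra_def)
qed

text \<open>
  If the functional \<open>a = cyc w x\<close> is nonzero on the radical, then an element \<open>e\<close> of the radical with
  \<open>a(e) = -1\<close> acts on the kernel of \<open>a\<close> from the right as the identity, by \<open>[b,e] = a(b) e - a(e) b\<close>.
\<close>

lemma kernel_abelian_or_almost_abelian:
  assumes hyp: "om w x = 1"
  shows "abelian Ker br \<or> almost_abelian scale Ker br"
proof (cases "\<forall>z\<in>Ker. cyc w x z = 0")
  case True
  then show ?thesis
    by (simp add: abelian_def kernel_bracket[OF hyp])
next
  case False
  then obtain z where z: "z \<in> Ker" "cyc w x z \<noteq> 0"
    by blast
  define e where "e = scale (- inverse (cyc w x z)) z"
  have e: "e \<in> Ker" "cyc w x e = - 1"
    using z subspace_kernel by (simp_all add: e_def subspace_scale cyc_linear del: scale_minus_left)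
  define B where "B = {a \<in> Ker. cyc w x a = 0}"
  have cyc_zero: "cyc w x 0 = 0"
    using cyc_linear(2)[of w x 0 0] by simp
  have subspace_B: "subspace B"
    using subspace_kernel by (auto simp: B_def subspace_def cyc_linear cyc_zero)
  have br_B: "br a v = scale (- cyc w x v) a" "br v a = scale (cyc w x v) a"
    if "a \<in> B" "v \<in> Ker" for a v
    using that by (auto simp: B_def kernel_bracket[OF hyp])
  have "ideal_of scale Ker br B"
    unfolding ideal_of_def using subspace_B
    by (auto simp: br_B subspace_scale simp del: scale_minus_left) (auto simp: B_def)
  moreover have "abelian B br"
    unfolding abelian_def by (auto simp: br_B) (auto simp: B_def kernel_bracket[OF hyp])
  moreover have "e \<noteq> 0"
    using e cyc_zero by auto
  moreover have "Ker = {a + b |a b. a \<in> B \<and> b \<in> span {e}}"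
  proof (intro equalityI subsetI)
    fix v assume "v \<in> Ker"
    then have "v + scale (cyc w x v) e \<in> B"
      using e subspace_kernel by (simp add: B_def subspace_add subspace_scale cyc_linear)
    moreover have "scale (- cyc w x v) e \<in> span {e}"
      by (simp add: span_base span_scale del: scale_minus_left)
    moreover have "v = (v + scale (cyc w x v) e) + scale (- cyc w x v) e"
      by simp
    ultimately show "v \<in> {a + b |a b. a \<in> B \<and> b \<in> span {e}}"
      by blast
  next
    fix v assume "v \<in> {a + b |a b. a \<in> B \<and> b \<in> span {e}}"
    then show "v \<in> Ker"
      using e subspace_kernel
      by (auto simp: B_def span_singleton intro!: subspace_add subspace_scale)
  qed
  moreover have "B \<inter> span {e} = {0}"
    using e by (auto simp: B_def span_singleton cyc_linear cyc_zero subspace_0[OF subspace_kernel])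
  moreover have "br a e = a" if "a \<in> B" for a
    using br_B(1)[OF that e(1)] e(2) by simp
  ultimately show ?thesis
    using lie_subalgebra_kernel[OF hyp] e(1)
    unfolding almost_abelian_def lie_subalgebra_def by blast
qed

section \<open>Forms of rank two\<close>

text \<open>
  The form is the orthogonal sum of a hyperbolic plane and its radical. Stated by means of a
  hyperbolic pair, the negation yields orthogonal pairs without a notion of rank.
\<close>

definition rank_two where
  "rank_two \<longleftrightarrow> (\<exists>w x. om w x = 1 \<and> (\<forall>v. om v w = 0 \<longrightarrow> om v x = 0 \<longrightarrow> v \<in> Ker))"

lemma kernel_codimension_two:
  assumes fin: "finite_dimensional_vector_space scale Basis"
    and hyp: "om w x = 1" and rank: "\<And>v. om v w = 0 \<Longrightarrow> om v x = 0 \<Longrightarrow> v \<in> Ker"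
  shows "dim UNIV = dim Ker + 2"
proof -
  interpret fin: finite_dimensional_vector_space scale Basis
    by (fact fin)
  obtain B where B: "B \<subseteq> Ker" "independent B" "Ker \<subseteq> span B" "card B = dim Ker"
    by (rule basis_exists)
  have span_B: "span B = Ker"
    using B subspace_kernel span_minimal by blast
  have "x \<notin> Ker"
    using hyp by (auto simp: kernel_om)
  then have x: "x \<notin> span B"
    by (simp add: span_B)
  have "w - scale k x \<notin> Ker" for k
    using hyp kernel_om(1)[of "w - scale k x" x] by (auto simp: om_linear om_self)
  then have w: "w \<notin> span (insert x B)"
    by (simp add: span_insert span_B)
  have "v \<in> span (insert w (insert x B))" for v
  proof -
    have "v - scale (om v x) w - scale (- om v w) x \<in> Ker"
      using hyp om_skew[of x w] by (intro rank) (simp_all add: om_linear om_self)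
    then show ?thesis
      unfolding span_insert[of w] span_insert[of x] span_B by blast
  qed
  moreover have "independent (insert w (insert x B))"
    by (intro independent_insertI w x B)
  moreover have "card (insert w (insert x B)) = dim Ker + 2"
    using B w x span_base[of x B] span_base[of w "insert x B"] fin.finiteI_independent[OF B(2)]
      span_base[of w B]
    by (subst card_insert_disjoint; (subst card_insert_disjoint)?) (auto intro: span_base)
  ultimately show ?thesis
    by (intro dim_unique[of "insert w (insert x B)"]) auto
qed

section \<open>Forms of higher rank: the action on the radical\<close>

text \<open>
  By assumption some \<open>w\<close> outside the radical is orthogonal to \<open>y\<close> and \<open>u\<close>. A partner of \<open>w\<close> is made
  orthogonal to \<open>y\<close> and \<open>u\<close> by subtracting its projection to their plane, which does not
  change its product with \<open>w\<close>.
\<close>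

lemma complementary_plane:
  assumes "\<not> rank_two" "om y u = 1"
  obtains w x where "om w x = 1" "om y w = 0" "om y x = 0" "om u w = 0" "om u x = 0"
proof -
  obtain w where w: "om w y = 0" "om w u = 0" "w \<notin> Ker"
    using assms unfolding rank_two_def by blast
  obtain v where v: "om w v = 1"
    using w(3) by (rule not_in_kernelE)
  define x where "x = v - scale (om v u) y + scale (om v y) u"
  have "om w x = 1" "om x y = 0" "om x u = 0"
    using w v assms(2) om_skew[of u y] by (simp_all add: x_def om_linear om_self)
  then show ?thesis
    using that[of w x] w om_skew[of y] om_skew[of u] by simp
qed

lemma bracket_with_kernel:
  assumes "om w x = 1" "om y w = 0" "om y x = 0" "z \<in> Ker"
  shows "br y z = scale (cyc w x y) z - scale (cyc x y z) w - scale (cyc y w z) x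
    - scale (cyc w x z) y"
  using four_element_identity[of w x y z] assms om_skew[of x y] by (simp add: kernel_om)

lemma kernel_action_on_plane:
  assumes "om w x = 1" "om y w = 0" "om y x = 0" "om u w = 0" "om u x = 0" "z \<in> Ker"
  shows "om (br y z) u = - cyc w x z * om y u"
  using assms om_skew[of w u] om_skew[of x u]
  by (simp add: bracket_with_kernel[OF assms(1-3,6)] om_linear kernel_om)

lemma cyc_kernel:
  assumes "z \<in> Ker"
  shows "cyc w x z = om (br x z) w - om (br w z) x"
  using assms by (simp add: cyc_def kernel_om br_skew[of z w] om_minus_left)

text \<open>
  For mutually orthogonal hyperbolic pairs \<open>(y,u)\<close> and \<open>(w,x)\<close>, the action of \<open>z\<close> on the first plane is
  governed by \<open>cyc w x z\<close>, which in turn is computed from the action on the second plane as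
  \<open>2 cyc y u z\<close>. By symmetry \<open>cyc y u z = 2 cyc w x z\<close>, so both vanish in characteristic other
  than 3.
\<close>

lemma kernel_action_on_hyperbolic_pair:
  assumes rank: "\<not> rank_two" and yu: "om y u = 1" and z: "z \<in> Ker"
  shows "om (br y z) u = 0"
proof -
  obtain w x where wx: "om w x = 1" "om y w = 0" "om y x = 0" "om u w = 0" "om u x = 0"
    using rank yu by (rule complementary_plane)
  have swap: "om u y = - 1" "om x w = - 1" "om w y = 0" "om w u = 0" "om x y = 0" "om x u = 0"
    using yu wx om_skew[of u y] om_skew[of x w] om_skew[of w y] om_skew[of w u] om_skew[of x y]
      om_skew[of x u] by auto
  have 1: "om (br y z) u = - cyc w x z" "om (br u z) y = cyc w x z"
    using wx z yu swap kernel_action_on_plane[of w x] by auto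
  have 2: "om (br w z) x = - cyc y u z" "om (br x z) w = cyc y u z"
    using wx z yu swap kernel_action_on_plane[of y u] by auto
  have "cyc w x z = 2 * cyc y u z"
    unfolding cyc_kernel[OF z, of w x] 2 by simp
  also have "cyc y u z = 2 * cyc w x z"
    unfolding cyc_kernel[OF z, of y u] 1 by simp
  finally have "3 * cyc w x z = 0"
    by algebra
  then show ?thesis
    using three_nonzero 1 by simp
qed

text \<open>
  The previous lemma gives \<open>om([y,z],u) = 0\<close> whenever \<open>om(y,u) \<noteq> 0\<close>. If \<open>om(y,u) = 0\<close>, write \<open>y\<close> as
  the difference of \<open>y + a\<close> and \<open>a\<close>, where \<open>om(a,u) \<noteq> 0\<close>.
\<close>

lemma bracket_kernel:
  assumes rank: "\<not> rank_two" and z: "z \<in> Ker"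
  shows "br y z \<in> Ker"
proof -
  have nonorthogonal: "om (br a z) b = 0" if "om a b \<noteq> 0" for a b
    using kernel_action_on_hyperbolic_pair[OF rank _ z, of a "scale (inverse (om a b)) b"] that
    by (simp add: om_scale_right)
  have "om (br y z) u = 0" for u
  proof (cases "\<exists>a. om a u \<noteq> 0")
    case True
    then obtain a where a: "om a u \<noteq> 0"
      by blast
    show ?thesis
    proof (cases "om y u = 0")
      case True
      then show ?thesis
        using a nonorthogonal[of a u] nonorthogonal[of "y + a" u] by (simp add: om_linear br_linear)
    qed (rule nonorthogonal)
  qed simp
  then show ?thesis
    by (simp add: mem_kernel_iff)
qed

lemma kernel_ideal:
  assumes "\<not> rank_two"
  shows "ideal_of scale UNIV br Ker"
  using bracket_kernel[OF assms] subspace_kernel subspace_neg br_skew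
  unfolding ideal_of_def by (metis subset_UNIV)

text \<open>
  Choose a hyperbolic pair \<open>(w,x)\<close> orthogonal to \<open>y\<close>. In the formula for \<open>[y,z]\<close> the cyclic sums with
  an argument from the radical vanish, because the radical is an ideal. This leaves
  \<open>[y,z] = (cyc w x y) z\<close>, where the scalar \<open>cyc w x y\<close> does not involve \<open>z\<close>.
\<close>

lemma scalar_action_on_kernel:
  assumes rank: "\<not> rank_two" and nonzero: "Ker \<noteq> UNIV"
  shows "\<exists>c. \<forall>z\<in>Ker. br y z = scale c z"
proof -
  obtain w x where wx: "om w x = 1" "om y w = 0" "om y x = 0"
  proof (cases "y \<in> Ker")
    case True
    obtain w where "w \<notin> Ker"
      using nonzero by blast
    then obtain x where "om w x = 1"
      by (rule not_in_kernelE)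
    then show ?thesis
      using that True by (simp add: kernel_om)
  next
    case False
    then obtain u where "om y u = 1"
      by (rule not_in_kernelE)
    with rank show ?thesis
      by (rule complementary_plane) (rule that)
  qed
  have "cyc a b z = 0" if "z \<in> Ker" for a b z
    using bracket_kernel[OF rank that] that by (simp add: cyc_kernel kernel_om)
  then show ?thesis
    using bracket_with_kernel[OF wx] by auto
qed

section \<open>The quotient by the radical\<close>

text \<open>
  For \<open>z\<close> in the ideal, the Jacobi-type identity shows that \<open>om(z,x) y - om(z,y) x\<close> lies in the ideal;
  so, if \<open>om(z,x) = 1\<close>, everything orthogonal to \<open>z\<close> does. In particular it contains an element \<open>a\<close>
  of a hyperbolic plane orthogonal to \<open>z\<close> and \<open>x\<close>. Applied to \<open>a\<close> instead of \<open>z\<close>, this places \<open>x\<close>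
  in the ideal, and \<open>x\<close> and the elements orthogonal to \<open>z\<close> span everything.
\<close>

lemma ideal_not_in_kernel:
  assumes rank: "\<not> rank_two" and I: "ideal_of scale UNIV br I" and "\<not> I \<subseteq> Ker"
  shows "I = UNIV"
proof -
  have sub: "subspace I"
    using I by (simp add: ideal_of_def)
  have br_I: "br a b \<in> I" "br b a \<in> I" if "a \<in> I" for a b
    using I that by (auto simp: ideal_of_def)
  have orth: "y \<in> I" if z: "z \<in> I" and zx: "om z x = 1" and zy: "om z y = 0" for x y z
  proof -
    have "y = br (br z x) y - br (br z y) x + br (br x y) z - scale (om x y) z"
      using jacobi_oriented[of z x y] zx zy by simp
    also have "\<dots> \<in> I"
      using z by (intro subspace_diff subspace_add subspace_scale br_I sub)
    finally show ?thesis .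
  qed
  obtain z where z: "z \<in> I" "z \<notin> Ker"
    using assms(3) by blast
  obtain x where zx: "om z x = 1"
    using z(2) by (rule not_in_kernelE)
  obtain a b where ab: "om a b = 1" "om z a = 0" "om z b = 0" "om x a = 0" "om x b = 0"
    using rank zx by (rule complementary_plane)
  have "a \<in> I"
    using orth z zx ab by blast
  then have "x \<in> I"
    using orth[of a b x] ab om_skew[of a x] by simp
  have "v \<in> I" for v
  proof -
    have "v - scale (om z v) x \<in> I"
      using orth[OF z(1) zx] zx by (simp add: om_linear)
    then show ?thesis
      using subspace_add[OF sub _ subspace_scale[OF sub \<open>x \<in> I\<close>]] by (metis diff_add_cancel)
  qed
  then show ?thesis
    by blast
qed

text \<open>
  The quotient by the radical is realised on a linear complement \<open>S\<close>, the image of a projection \<open>p\<close>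
  whose kernel is the radical. Since the radical is an ideal, brackets can be reduced modulo it
  in either argument, which makes \<open>p\<close> a homomorphism onto \<open>S\<close> with the bracket \<open>p [s,t]\<close>.
\<close>

lemma extension_of_simple:
  assumes rank: "\<not> rank_two" and nonzero: "Ker \<noteq> UNIV"
  shows "abelian_extension_of_simple scale UNIV br om"
proof -
  interpret pair: vector_space_pair scale scale
    by unfold_locales
  obtain g where g: "range g \<subseteq> Ker" "Vector_Spaces.linear scale scale g" "\<And>v. v \<in> Ker \<Longrightarrow> g v = v"
    using pair.linear_exists_left_inverse_on[OF linear_id subspace_kernel] by auto
  interpret g: Vector_Spaces.linear scale scale g
    by (rule g(2))
  define p where "p v = v - g v" for v
  have p_add: "p (u + v) = p u + p v" and p_scale: "p (scale c v) = scale c (p v)" for u v c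
    by (simp_all add: p_def g.add g.scale scale_right_diff_distrib)
  have p_zero: "p 0 = 0"
    using p_scale[of 0 0] by simp
  have p_minus: "p (- v) = - p v" for v
    using p_scale[of "-1" v] by simp
  have diff_kernel: "v - p v \<in> Ker" for v
    using g(1) by (auto simp: p_def)
  have p_eq_0: "p v = 0 \<longleftrightarrow> v \<in> Ker" for v
    using g(1,3) unfolding p_def by (metis eq_iff_diff_eq_0 rangeI subset_iff)
  have p_eq: "p u = p v" if "u - v \<in> Ker" for u v
    using p_add[of "u - v" v] that by (simp flip: p_eq_0)
  have p_p: "p (p v) = p v" for v
    using p_eq[OF diff_kernel[of v]] by simp
  have om_p: "om (p u) v = om u v" "om u (p v) = om u v" for u v
    using kernel_om(1)[OF diff_kernel[of u], of v] kernel_om(2)[OF diff_kernel[of v], of u]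
    by (simp_all add: om_linear)
  have "br u v - br (p u) v \<in> Ker" "br u v - br u (p v) \<in> Ker" for u v
    using kernel_ideal[OF rank] diff_kernel[of u] diff_kernel[of v]
    by (auto simp: ideal_of_def simp flip: br_diff_left br_diff_right)
  then have p_br: "p (br (p u) v) = p (br u v)" "p (br u (p v)) = p (br u v)" for u v
    by (metis p_eq)+
  define S where "S = range p"
  define brS where "brS s t = p (br s t)" for s t
  have S_iff: "s \<in> S \<longleftrightarrow> p s = s" for s
    unfolding S_def by (metis p_p rangeE rangeI)
  have S: "omega_lie_algebra scale S brS om"
  proof unfold_locales
    show "subspace S"
      by (auto simp: subspace_def S_iff p_add p_scale p_zero)
    show "brS x y = - brS y x" for x y
      using br_skew[of x y] by (simp add: brS_def p_minus)
    show "brS (brS x y) z + brS (brS z x) y + brS (brS y z) x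
        = scale (om x y) z + scale (om z x) y + scale (om y z) x"
      if "x \<in> S" "y \<in> S" "z \<in> S" for x y z
      using arg_cong[OF omega_jacobi[of x y z], of p] that
      by (simp add: brS_def p_br p_add p_scale S_iff)
  qed (auto simp: bilinear_map_on_def linear_map_on_def brS_def br_linear om_linear p_add p_scale
      p_p S_iff)
  have nondegenerate: "nondegenerate S om"
  proof -
    have "s = 0" if "s \<in> S" "\<forall>t\<in>S. om s t = 0" for s
    proof -
      have "om s v = 0" for v
        using that(2) om_p(2)[of s v] by (simp add: S_def)
      then have "p s = 0"
        by (simp add: p_eq_0 mem_kernel_iff)
      then show ?thesis
        using that(1) by (simp add: S_iff)
    qed
    moreover have "0 \<in> S"
      by (simp add: S_iff p_zero)
    ultimately show ?thesis
      by (auto simp: nondegenerate_def form_kernel_def om_linear)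
  qed
  have simple: "simple_algebra scale S brS"
    unfolding simple_algebra_def
  proof (intro conjI allI impI)
    show "\<not> abelian S brS"
    proof
      assume ab: "abelian S brS"
      have "p (br u v) = 0" for u v
        using ab p_br by (simp add: abelian_def brS_def S_def)
      then have br_kernel: "br u v \<in> Ker" for u v
        by (simp add: p_eq_0)
      obtain y where "y \<notin> Ker"
        using nonzero by blast
      then obtain u where yu: "om y u = 1"
        by (rule not_in_kernelE)
      obtain w x where wx: "om w x = 1" "om y w = 0" "om y x = 0"
        using rank yu by (rule complementary_plane)
      \<comment> \<open>If all brackets lie in the radical, then so does any \<open>y\<close> orthogonal to a hyperbolic pair.\<close>
      have "y = br (br y w) x - br (br y x) w + br (br w x) y"
        using jacobi_oriented[of y w x] wx by simp
      also have "\<dots> \<in> Ker"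
        by (intro subspace_diff subspace_add br_kernel subspace_kernel)
      finally show False
        using \<open>y \<notin> Ker\<close> by contradiction
    qed
  next
    fix J assume J: "ideal_of scale S brS J"
    then have J_sub: "J \<subseteq> S" "subspace J"
      and J_br: "\<And>x y. x \<in> J \<Longrightarrow> y \<in> S \<Longrightarrow> brS x y \<in> J \<and> brS y x \<in> J"
      by (auto simp: ideal_of_def)
    have pre: "ideal_of scale UNIV br {v. p v \<in> J}"
      unfolding ideal_of_def
    proof (intro conjI ballI)
      show "subspace {v. p v \<in> J}"
        using J_sub(2) by (auto simp: subspace_def p_add p_scale p_zero)
      fix x y assume "x \<in> {v. p v \<in> J}"
      then show "br x y \<in> {v. p v \<in> J}" "br y x \<in> {v. p v \<in> J}"
        using J_br[of "p x" "p y"] by (auto simp: brS_def p_br S_def)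
    qed simp
    show "J = {0} \<or> J = S"
    proof (cases "{v. p v \<in> J} \<subseteq> Ker")
      case True
      have "J \<subseteq> {0}"
      proof
        fix s assume "s \<in> J"
        then have "p s = s"
          using J_sub(1) by (auto simp: S_iff)
        then show "s \<in> {0}"
          using True \<open>s \<in> J\<close> p_eq_0[of s] by auto
      qed
      then show ?thesis
        using subspace_0[OF J_sub(2)] by blast
    next
      case False
      then have "{v. p v \<in> J} = UNIV"
        by (rule ideal_not_in_kernel[OF rank pre])
      then show ?thesis
        using J_sub(1) by (auto simp: S_def)
    qed
  qed
  \<comment> \<open>If the radical is zero, any \<open>l\<close> satisfies this; so its linearity needs a nonzero radical.\<close>
  obtain l where l: "\<And>v z. z \<in> Ker \<Longrightarrow> br v z = scale (l v) z"
    using scalar_action_on_kernel[OF rank nonzero] by metis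
  have ab: "abelian Ker br"
    unfolding abelian_def
  proof (intro ballI)
    fix x y assume "x \<in> Ker" "y \<in> Ker"
    then have "scale (l x) x = 0"
      using l[of x x] by (simp add: br_self)
    then show "br x y = 0"
      using l[of y x] \<open>y \<in> Ker\<close> by (cases "x = 0") (auto simp: l br_linear)
  qed
  have l_linear: "linear_map_on scale (*) S l" "\<forall>s\<in>S. \<forall>t\<in>S. om s t = l (brS s t)"
    "\<forall>x\<in>UNIV. \<forall>m\<in>Ker. br x m = scale (l (p x)) m" if nontrivial: "Ker \<noteq> {0}"
  proof -
    obtain z where z: "z \<in> Ker" "z \<noteq> 0"
      using nontrivial subspace_0[OF subspace_kernel] by blast
    have l_eq: "l u = c \<longleftrightarrow> br u z = scale c z" for u c
      using z by (simp add: l)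
    have l_add: "l (u + v) = l u + l v" and l_scale: "l (scale c v) = c * l v" for u v c
      unfolding l_eq by (simp_all add: br_linear l z scale_left_distrib)
    have l_kernel: "l v = 0" if "v \<in> Ker" for v
      unfolding l_eq using ab that z by (simp add: abelian_def)
    have l_p: "l (p v) = l v" for v
      using l_add[of "v - p v" "p v"] by (simp add: l_kernel diff_kernel)
    have l_br: "om s t = l (br s t)" for s t
    proof -
      have "br (br s t) z = scale (om s t) z"
        using jacobi_oriented[of s t z] z
        by (simp add: l kernel_om br_linear br_skew[of z s] br_skew[of z t] mult.commute[of "l s" "l t"])
      then show ?thesis
        by (metis l_eq)
    qed
    show "linear_map_on scale (*) S l"
      by (simp add: linear_map_on_def l_add l_scale)
    show "\<forall>s\<in>S. \<forall>t\<in>S. om s t = l (brS s t)"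
      by (simp add: brS_def l_p l_br)
    show "\<forall>x\<in>UNIV. \<forall>m\<in>Ker. br x m = scale (l (p x)) m"
      by (simp add: l l_p)
  qed
  have "abelian_extension scale UNIV br om scale S brS om"
    unfolding abelian_extension_def
  proof (intro conjI exI[of _ Ker] exI[of _ p] impI exI[of _ l] kernel_ideal[OF rank] ab l_linear S)
    show "omega_lie_algebra scale UNIV br om"
      by unfold_locales
  qed (auto simp: linear_map_on_def p_add p_scale S_def p_eq_0 brS_def p_br om_p)
  then show ?thesis
    unfolding abelian_extension_of_simple_def using simple nondegenerate by blast
qed

end

theorem lemma5p4:
  fixes scale :: "'k::field \<Rightarrow> 'a::ab_group_add \<Rightarrow> 'a"
    and Basis :: "'a set"
    and br :: "'a \<Rightarrow> 'a \<Rightarrow> 'a"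
    and om :: "'a \<Rightarrow> 'a \<Rightarrow> 'k"
  assumes "CHAR('k) \<noteq> 2" and "CHAR('k) \<noteq> 3"
    and "finite_dimensional_vector_space scale Basis"
    and "omega_lie_algebra scale UNIV br om"
    and "\<not> lie_algebra scale UNIV br"
  shows
    "(\<exists>H. lie_subalgebra scale UNIV br H \<and>
        vector_space.dim scale UNIV = vector_space.dim scale H + 1)
     \<or> (lie_subalgebra scale UNIV br (form_kernel UNIV om) \<and>
        (abelian (form_kernel UNIV om) br \<or> almost_abelian scale (form_kernel UNIV om) br) \<and>
        vector_space.dim scale UNIV = vector_space.dim scale (form_kernel UNIV om) + 2)
     \<or> abelian_extension_of_simple scale UNIV br om"
proof -
  have "c = 1 \<or> c = 2" if "c dvd 2" for c :: nat
    using dvd_imp_le[OF that] that by (cases "c = 0") auto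
  moreover have "c = 1 \<or> c = 3" if "c dvd 3" for c :: nat
  proof -
    have "c \<noteq> 0" "c \<noteq> 2" "c \<le> 3"
      using dvd_imp_le[OF that] that by (auto intro: Nat.gr0I)
    then show ?thesis
      by linarith
  qed
  ultimately have "\<not> CHAR('k) dvd 2" "\<not> CHAR('k) dvd 3"
    using assms(1,2) by fastforce+
  then have "(2::'k) \<noteq> 0" "(3::'k) \<noteq> 0"
    by (metis of_nat_eq_0_iff_char_dvd of_nat_numeral)+
  then interpret total_omega_lie_algebra scale br om
    by (intro total_omega_lie_algebra.intro total_omega_lie_algebra_axioms.intro assms)
  have nonzero: "Ker \<noteq> UNIV"
  proof
    assume "Ker = UNIV"
    then have "br (br x y) z + br (br z x) y + br (br y z) x = 0" for x y z
      using omega_jacobi[of x y z] kernel_om(1) by simp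
    then have "lie_algebra scale UNIV br"
      by unfold_locales
    with assms(5) show False ..
  qed
  show ?thesis
  proof (cases rank_two)
    case True
    then obtain w x where wx: "om w x = 1" "\<And>v. om v w = 0 \<Longrightarrow> om v x = 0 \<Longrightarrow> v \<in> Ker"
      unfolding rank_two_def by blast
    then show ?thesis
      using lie_subalgebra_kernel kernel_abelian_or_almost_abelian
        kernel_codimension_two[OF assms(3)] by blast
  next
    case False
    then show ?thesis
      using extension_of_simple nonzero by blast
  qed
qed

end
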